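(* Let $n\geq1$, $\boldsymbol{\varepsilon}=(\varepsilon_1,\ldots,\varepsilon_n)\in\{\pm1\}^n$, let $C=C(\boldsymbol{\varepsilon})$ be the graphical scheme of dimension $n$ with $C_{i,j}=\prod_{k=i}^j\varepsilon_k$, and let $C_-$ be the scheme generated by $(-1,\ldots,-1)$, i.e. $(C_-)_{i,j}=(-1)^{j-i+1}$. Then there is a finite list of moves of types $\mathrm{P}$, $\mathrm{H}$, $\mathrm{V}$ and $\mathrm{S}$ which, applied successively, transforms $C$ into $C_-$.
   Context: A graphical scheme of dimension $n$ is an assignment of a sign $C_{i,j}\in\{+,-\}$ to each pair $1\leq i\leq j\leq n$. The moves, each changing only the indicated entries and applicable only when the indicated entries have the indicated signs, are: $\mathrm{P}(i;j)$: changes $C_{i,j}=+$ to $-$. $\mathrm{H}(i;j,j')$ with $j<j'$: changes $C_{i,j}=+$, $C_{i,j'}=-$ into $C_{i,j}=-$, $C_{i,j'}=+$. $\mathrm{V}(i,i';j)$ with $i<i'\leq j$: changes $C_{i,j}=-$, $C_{i',j}=+$ into $C_{i,j}=+$, $C_{i',j}=-$. $\mathrm{S}(i,i';j,j')$ with $i<i'\leq j<j'$: changes $C_{i,j}=-$, $C_{i,j'}=+$, $C_{i',j}=+$, $C_{i',j'}=-$ into $C_{i,j}=+$, $C_{i,j'}=-$, $C_{i',j}=-$, $C_{i',j'}=+$. *)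

theory Defs
  imports Main "HOL-Library.FuncSet"
begin

text \<open>Signs are the integers \<open>1\<close> and \<open>-1\<close>. A scheme of dimension \<open>n\<close> is an extensional function
  on the triangle of index pairs, so equality of schemes is equality of their entries.\<close>

type_synonym scheme = "nat \<times> nat \<Rightarrow> int"

definition signs :: "int set" where
  "signs = {1, -1}"

definition triangle :: "nat \<Rightarrow> (nat \<times> nat) set" where
  "triangle n = {(i, j). 1 \<le> i \<and> i \<le> j \<and> j \<le> n}"

definition graphical_schemes :: "nat \<Rightarrow> scheme set" where
  "graphical_schemes n = triangle n \<rightarrow>\<^sub>E signs"

definition generated_scheme :: "nat \<Rightarrow> (nat \<Rightarrow> int) \<Rightarrow> scheme" where
  "generated_scheme n \<epsilon> = (\<lambda>(i, j) \<in> triangle n. \<Prod>k = i..j. \<epsilon> k)"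

definition minus_scheme :: "nat \<Rightarrow> scheme" where
  "minus_scheme n = generated_scheme n (\<lambda>_. -1)"

datatype move =
    Move_P nat nat          \<comment> \<open>\<open>P(i;j)\<close>\<close>
  | Move_H nat nat nat      \<comment> \<open>\<open>H(i;j,j')\<close>\<close>
  | Move_V nat nat nat      \<comment> \<open>\<open>V(i,i';j)\<close>\<close>
  | Move_S nat nat nat nat  \<comment> \<open>\<open>S(i,i';j,j')\<close>\<close>

fun applicable :: "nat \<Rightarrow> move \<Rightarrow> scheme \<Rightarrow> bool" where
  "applicable n (Move_P i j) C \<longleftrightarrow>
     1 \<le> i \<and> i \<le> j \<and> j \<le> n \<and> C (i, j) = 1"
| "applicable n (Move_H i j j') C \<longleftrightarrow>
     1 \<le> i \<and> i \<le> j \<and> j < j' \<and> j' \<le> n \<and> C (i, j) = 1 \<and> C (i, j') = -1"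
| "applicable n (Move_V i i' j) C \<longleftrightarrow>
     1 \<le> i \<and> i < i' \<and> i' \<le> j \<and> j \<le> n \<and> C (i, j) = -1 \<and> C (i', j) = 1"
| "applicable n (Move_S i i' j j') C \<longleftrightarrow>
     1 \<le> i \<and> i < i' \<and> i' \<le> j \<and> j < j' \<and> j' \<le> n \<and>
     C (i, j) = -1 \<and> C (i, j') = 1 \<and> C (i', j) = 1 \<and> C (i', j') = -1"

fun apply_move :: "move \<Rightarrow> scheme \<Rightarrow> scheme" where
  "apply_move (Move_P i j) C = C((i, j) := -1)"
| "apply_move (Move_H i j j') C = C((i, j) := -1, (i, j') := 1)"
| "apply_move (Move_V i i' j) C = C((i, j) := 1, (i', j) := -1)"
| "apply_move (Move_S i i' j j') C =
     C((i, j) := 1, (i, j') := -1, (i', j) := -1, (i', j') := 1)"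

fun transforms :: "nat \<Rightarrow> move list \<Rightarrow> scheme \<Rightarrow> scheme \<Rightarrow> bool" where
  "transforms n [] C D \<longleftrightarrow> C = D"
| "transforms n (m # ms) C D \<longleftrightarrow> applicable n m C \<and> transforms n ms (apply_move m C) D"

lemma generated_scheme_in_graphical_schemes:
  assumes "\<forall>k \<in> {1..n}. \<epsilon> k \<in> signs"
  shows "generated_scheme n \<epsilon> \<in> graphical_schemes n"
proof -
  have prod_sign: "prod \<epsilon> A \<in> signs" if "finite A" "\<forall>k \<in> A. \<epsilon> k \<in> signs" for A
    using that by (induction A rule: finite_induct) (auto simp: signs_def)
  have "prod \<epsilon> {i..j} \<in> signs" if "(i, j) \<in> triangle n" for i j
    using that assms by (intro prod_sign) (auto simp: triangle_def)
  then show ?thesis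
    by (auto simp: generated_scheme_def graphical_schemes_def)
qed

lemma minus_scheme_entry:
  assumes "(i, j) \<in> triangle n"
  shows "minus_scheme n (i, j) = (-1) ^ (j - i + 1)"
  using assms by (simp add: minus_scheme_def generated_scheme_def triangle_def Suc_diff_le)

lemma apply_move_in_graphical_schemes:
  assumes "C \<in> graphical_schemes n" and "applicable n m C"
  shows "apply_move m C \<in> graphical_schemes n"
  using assms
  by (cases m) (auto simp: graphical_schemes_def signs_def triangle_def PiE_iff extensional_def)

end

theory Submission
  imports Defs
begin

text \<open>Index the vertices of a complete graph by \<open>0, \<dots>, n\<close> and read \<open>C\<^bsub>i,j\<^esub>\<close> as a label of the edge
  between \<open>i - 1\<close> and \<open>j\<close>. A scheme generated by signs has labels \<open>d (i - 1) * d j\<close>, where the signs \<open>d\<close>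
  are the steps of a walk \<open>h\<close> on \<open>0, \<dots>, n + 1\<close>. Suppose \<open>h \<le> M\<close>, and fold the walk by replacing every
  value \<open>M\<close> by \<open>M - 2\<close>. This reverses exactly the steps touching level \<open>M\<close>, so it negates the labels of
  the edges joining such a step to one that stays below \<open>M\<close>. The former come in peaks (an up step
  followed by a down step, or a single step at an end of the walk). Among the latter, match each down
  step with the up step at which the walk first returns to its height; an unmatched up step precedes all
  peaks and an unmatched down step follows them. The edges between one peak and one matched pair or
  unmatched step form the support of one applicable move, and these supports are disjoint. Folding
  repeatedly shrinks the range of the walk to two consecutive values, where the steps alternate.\<close>

section \<open>Moves as sign changes on a support\<close>

definition flip :: "(nat \<times> nat) set \<Rightarrow> scheme \<Rightarrow> scheme" where
  "flip E C = (\<lambda>e. if e \<in> E then - C e else C e)"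

fun support :: "move \<Rightarrow> (nat \<times> nat) set" where
  "support (Move_P i j) = {(i, j)}"
| "support (Move_H i j j') = {(i, j), (i, j')}"
| "support (Move_V i i' j) = {(i, j), (i', j)}"
| "support (Move_S i i' j j') = {(i, j), (i, j'), (i', j), (i', j')}"

lemma apply_move_eq_flip: "applicable n m C \<Longrightarrow> apply_move m C = flip (support m) C"
  by (cases m) (auto simp: flip_def fun_eq_iff)

lemma applicable_cong:
  assumes "\<And>e. e \<in> support m \<Longrightarrow> C e = D e"
  shows "applicable n m C \<longleftrightarrow> applicable n m D"
  using assms by (cases m) auto

lemma transforms_append:
  "transforms n ms C D \<Longrightarrow> transforms n ms' D E \<Longrightarrow> transforms n (ms @ ms') C E"
  by (induction ms arbitrary: C) auto

text \<open>Each move alters signs only on its own support, so performing one leaves the others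
  applicable, in whatever order they come.\<close>

lemma transforms_disjoint_flips:
  assumes "finite B" "pairwise disjnt B"
    and "\<And>E. E \<in> B \<Longrightarrow> \<exists>m. applicable n m C \<and> support m = E"
  shows "\<exists>ms. transforms n ms C (flip (\<Union>B) C)"
  using assms
proof (induction B rule: finite_induct)
  case empty
  have "transforms n [] C (flip (\<Union>{}) C)"
    by (simp add: flip_def)
  then show ?case by blast
next
  case (insert E B)
  from insert.prems(1) have "pairwise disjnt B"
    by (simp add: pairwise_insert)
  with insert obtain ms where ms: "transforms n ms C (flip (\<Union>B) C)"
    by blast
  obtain m where m: "applicable n m C" "support m = E"
    using insert.prems(2) by blast
  have disj: "E \<inter> \<Union>B = {}"
    using insert.prems(1) insert.hyps(2) by (auto simp: pairwise_insert disjnt_def)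
  have "applicable n m (flip (\<Union>B) C)"
    using m disj by (subst applicable_cong[of m _ C]) (auto simp: flip_def)
  moreover have "flip E (flip (\<Union>B) C) = flip (\<Union>(insert E B)) C"
    using disj by (auto simp: flip_def fun_eq_iff)
  ultimately have "transforms n [m] (flip (\<Union>B) C) (flip (\<Union>(insert E B)) C)"
    using m(2) by (simp add: apply_move_eq_flip)
  with ms show ?case
    using transforms_append by blast
qed

section \<open>Schemes of walks\<close>

definition step :: "(nat \<Rightarrow> int) \<Rightarrow> nat \<Rightarrow> int" where
  "step h k = h (Suc k) - h k"

definition walk_scheme :: "nat \<Rightarrow> (nat \<Rightarrow> int) \<Rightarrow> scheme" where
  "walk_scheme n h = (\<lambda>(i, j) \<in> triangle n. step h (i - 1) * step h j)"

text \<open>The edge joining steps \<open>a < b\<close> sits at index \<open>(Suc a, b)\<close>. The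
  disjunction lets either set supply the earlier step.\<close>

definition edges_between :: "nat set \<Rightarrow> nat set \<Rightarrow> (nat \<times> nat) set" where
  "edges_between A B = {(Suc a, b) | a b. a < b \<and> (a \<in> A \<and> b \<in> B \<or> a \<in> B \<and> b \<in> A)}"

lemma walk_scheme_Suc [simp]:
  "a < b \<Longrightarrow> b \<le> n \<Longrightarrow> walk_scheme n h (Suc a, b) = step h a * step h b"
  by (simp add: walk_scheme_def triangle_def)

lemma disjnt_edges_between:
  assumes "A \<inter> A' = {} \<or> B \<inter> B' = {}" "A \<inter> B' = {}" "A' \<inter> B = {}"
  shows "disjnt (edges_between A B) (edges_between A' B')"
proof (rule ccontr)
  assume "\<not> disjnt (edges_between A B) (edges_between A' B')"
  then obtain a b where "a \<in> A \<and> b \<in> B \<or> a \<in> B \<and> b \<in> A" "a \<in> A' \<and> b \<in> B' \<or> a \<in> B' \<and> b \<in> A'"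
    by (auto simp: edges_between_def disjnt_def)
  with assms show False by blast
qed

locale walk =
  fixes n :: nat and h :: "nat \<Rightarrow> int"
  assumes step_sign: "k \<le> n \<Longrightarrow> step h k = 1 \<or> step h k = -1"
begin

text \<open>Telescoping: every inner step occurs twice in the product and squares to 1, leaving the
  two outer steps.\<close>

lemma walk_scheme_eq_generated:
  "walk_scheme n h = generated_scheme n (\<lambda>k. step h (k - 1) * step h k)"
proof -
  have telescope: "step h a * step h b = (\<Prod>k = Suc a..b. step h (k - 1) * step h k)"
    if "a < b" "b \<le> n" for a b
    using that
  proof (induction b)
    case (Suc b)
    show ?case
    proof (cases "a = b")
      case False
      then have "step h a * step h b = (\<Prod>k = Suc a..b. step h (k - 1) * step h k)"
        using Suc by simp
      moreover have "step h b * step h b = 1"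
        using step_sign[of b] Suc.prems by auto
      ultimately show ?thesis
        using Suc.prems by (simp add: mult.assoc[symmetric])
          (metis mult.assoc mult.right_neutral)
    qed simp
  qed simp
  have "step h (i - 1) * step h j = (\<Prod>k = i..j. step h (k - 1) * step h k)"
    if "(i, j) \<in> triangle n" for i j
  proof -
    have "i - 1 < j" "j \<le> n" "Suc (i - 1) = i"
      using that by (auto simp: triangle_def)
    then show ?thesis
      using telescope[of "i - 1" j] by simp
  qed
  then show ?thesis
    unfolding walk_scheme_def generated_scheme_def
    by (intro restrict_ext) (simp only: split_paired_all case_prod_conv)
qed

text \<open>With only two heights available, up and down steps alternate, so every generating sign
  is \<open>-1\<close>.\<close>

lemma walk_scheme_two_values:
  assumes "\<And>k. k \<le> Suc n \<Longrightarrow> m \<le> h k \<and> h k \<le> m + 1"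
  shows "walk_scheme n h = minus_scheme n"
proof -
  have alt: "step h (k - 1) * step h k = -1" if k: "1 \<le> k" "k \<le> n" for k
  proof -
    obtain l where l: "k = Suc l"
      using k by (cases k) auto
    show ?thesis
      using step_sign[of l] step_sign[of k] assms[of l] assms[of k] assms[of "Suc k"] k
      by (auto simp: l step_def)
  qed
  have "(\<Prod>k = i..j. step h (k - 1) * step h k) = (\<Prod>k = i..j. -1)"
    if "(i, j) \<in> triangle n" for i j
    using that by (intro prod.cong refl alt) (simp_all add: triangle_def)
  then show ?thesis
    unfolding walk_scheme_eq_generated minus_scheme_def generated_scheme_def
    by (intro restrict_ext) (simp only: split_paired_all case_prod_conv)
qed

end

section \<open>Folding a walk at its maximum\<close>

text \<open>Reflection of level \<open>M\<close> in level \<open>M - 1\<close>. In a walk bounded by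
  \<open>M\<close>, the neighbours of a value \<open>M\<close> are \<open>M - 1\<close>, so unit
  steps are preserved.\<close>

definition fold_top :: "int \<Rightarrow> (nat \<Rightarrow> int) \<Rightarrow> nat \<Rightarrow> int" where
  "fold_top M h k = (if h k = M then M - 2 else h k)"

locale bounded_walk = walk +
  fixes M :: int
  assumes le_M: "k \<le> Suc n \<Longrightarrow> h k \<le> M"
begin

definition high :: "nat set" where
  "high = {k. k \<le> n \<and> (h k = M \<or> h (Suc k) = M)}"

definition low :: "nat set" where
  "low = {k. k \<le> n \<and> h k \<noteq> M \<and> h (Suc k) \<noteq> M}"

text \<open>A singleton if \<open>p\<close> is an end of the walk, that is, \<open>p = 0\<close> or \<open>p = n + 1\<close>.\<close>

definition peak :: "nat \<Rightarrow> nat set" where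
  "peak p = {k. k \<le> n \<and> (k = p \<or> Suc k = p)}"

section \<open>Matching of down steps with first-return up steps\<close>

definition matched :: "nat \<Rightarrow> nat \<Rightarrow> bool" where
  "matched a b \<longleftrightarrow> a < b \<and> b \<le> n \<and> h (Suc b) = h a \<and> (\<forall>k. a < k \<and> k \<le> b \<longrightarrow> h k < h a)"

definition valley :: "nat \<Rightarrow> nat set" where
  "valley k = {l. l = k \<or> matched k l \<or> matched l k}"

lemma step_cases: "k \<le> n \<Longrightarrow> h (Suc k) = h k + 1 \<or> h (Suc k) = h k - 1"
  using step_sign[of k] by (auto simp: step_def)

lemma matched_steps:
  assumes "matched a b"
  shows "step h a = -1" "step h b = 1"
  using assms step_cases[of a] step_cases[of b] by (auto simp: matched_def step_def)

text \<open>The longer of two candidate stretches would contain the end of the shorter one, whose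
  height is \<open>h a\<close> and not below it.\<close>

lemma matched_unique_right:
  assumes "matched a b" "matched a b'"
  shows "b = b'"
proof (rule ccontr)
  assume "b \<noteq> b'"
  then have "Suc b \<le> b' \<or> Suc b' \<le> b" by auto
  with assms show False
    unfolding matched_def by (metis less_SucI less_irrefl)
qed

lemma matched_unique_left:
  assumes "matched a b" "matched a' b"
  shows "a = a'"
proof (rule ccontr)
  assume "a \<noteq> a'"
  then have "a < a' \<or> a' < a" by auto
  with assms show False
    by (force simp: matched_def)
qed

text \<open>A right partner is an up step, a left partner a down step. Together with uniqueness this
  bounds a valley by two elements.\<close>

lemma matched_not_chained: "matched a b \<Longrightarrow> \<not> matched b c"
  using matched_steps[of a b] matched_steps[of b c] by auto

lemma matched_valley:
  assumes "matched a b"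
  shows "valley a = {a, b}" "valley b = {a, b}"
proof -
  show "valley a = {a, b}"
    unfolding valley_def using assms matched_unique_right matched_not_chained by blast
  show "valley b = {a, b}"
    unfolding valley_def using assms matched_unique_left matched_not_chained by blast
qed

lemma valley_cases:
  obtains (pair) a b where "matched a b" "valley k = {a, b}" "k = a \<or> k = b"
  | (single) "valley k = {k}" "\<And>l. \<not> matched k l" "\<And>l. \<not> matched l k"
proof -
  consider b where "matched k b" | a where "matched a k"
    | "\<And>l. \<not> matched k l" "\<And>l. \<not> matched l k"
    by blast
  then show thesis
  proof cases
    case 1
    then show thesis
      using matched_valley by (intro pair) auto
  next
    case 2
    then show thesis
      using matched_valley by (intro pair) auto
  next
    case 3
    then show thesis
      by (intro single) (auto simp: valley_def)
  qed
qed

text \<open>Valleys that meet coincide, so they partition the steps; this later makes the supports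
  disjoint.\<close>

lemma valley_eq:
  assumes "x \<in> valley k"
  shows "valley x = valley k"
proof (cases k rule: valley_cases)
  case (pair a b)
  then show ?thesis
    using assms matched_valley[OF pair(1)] by auto
qed (use assms in auto)

text \<open>The walk drops below \<open>h a\<close>, and unit steps cannot skip a level, so the
  first later time with height at least \<open>h a\<close> has exactly that height.\<close>

lemma exists_match_right:
  assumes "a < q" "q \<le> Suc n" "step h a = -1" "h a \<le> h q"
  shows "\<exists>b. matched a b"
proof -
  define j where "j = (LEAST j. a < j \<and> h a \<le> h j)"
  have j: "a < j \<and> h a \<le> h j"
    unfolding j_def by (rule LeastI[of _ q]) (use assms in simp)
  have "j \<le> q"
    unfolding j_def by (rule Least_le) (use assms in simp)
  have before: "h k < h a" if "a < k" "k < j" for k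
    using not_less_Least[of k "\<lambda>j. a < j \<and> h a \<le> h j"] that by (auto simp: j_def)
  have "j \<noteq> Suc a"
    using j assms(3) by (auto simp: step_def)
  then obtain b where b: "j = Suc b" "a < b"
    using j by (cases j) auto
  have "b \<le> n"
    using b \<open>j \<le> q\<close> assms(2) by simp
  moreover have "h (Suc b) = h a"
    using step_cases[OF \<open>b \<le> n\<close>] before[of b] j b by auto
  ultimately show ?thesis
    using b before by (auto simp: matched_def)
qed

text \<open>Time reversal of the previous argument, using the last time up to \<open>b\<close> with
  height at least \<open>h (Suc b)\<close>.\<close>

lemma exists_match_left:
  assumes "q \<le> b" "b \<le> n" "step h b = 1" "h (Suc b) \<le> h q"
  shows "\<exists>a. matched a b"
proof -
  define a where "a = (GREATEST j. j \<le> b \<and> h (Suc b) \<le> h j)"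
  have a: "a \<le> b \<and> h (Suc b) \<le> h a"
    unfolding a_def by (rule GreatestI_nat[of _ q b]) (use assms in auto)
  have after: "h k < h (Suc b)" if "a < k" "k \<le> b" for k
    using Greatest_le_nat[of "\<lambda>j. j \<le> b \<and> h (Suc b) \<le> h j" k b] that by (force simp: a_def)
  have "a \<noteq> b"
    using a assms(3) by (auto simp: step_def)
  then have "a < b"
    using a by simp
  moreover have "h a = h (Suc b)"
    using step_cases[of a] after[of "Suc a"] a \<open>a < b\<close> assms(2) by auto
  ultimately show ?thesis
    using after assms(2) by (auto simp: matched_def)
qed

section \<open>The move between one peak and one valley\<close>

lemma peak_steps:
  assumes "h p = M"
  shows "p \<le> n \<Longrightarrow> step h p = -1" "Suc q = p \<Longrightarrow> q \<le> n \<Longrightarrow> step h q = 1"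
  using assms step_cases[of p] step_cases[of q] le_M[of "Suc p"] le_M[of q]
  by (auto simp: step_def)

text \<open>From \<open>a\<close> to \<open>Suc b\<close> the walk never exceeds \<open>h a\<close>,
  which here is below \<open>M\<close>.\<close>

lemma matched_peak_sides:
  assumes "matched a b" "h p = M" "h a \<noteq> M"
  shows "p < a \<or> Suc b < p"
proof (rule ccontr)
  assume "\<not> (p < a \<or> Suc b < p)"
  then have "p = a \<or> p = Suc b \<or> a < p \<and> p \<le> b" by auto
  then show False
    using assms le_M[of a] by (auto simp: matched_def)
qed

text \<open>The earlier of the two blocks gives the rows (shifted by one), the later the columns. An
  interior peak gives two rows and two columns, hence \<open>S\<close>; a peak at time 0 has a
  single row, hence \<open>H\<close>; a peak at \<open>Suc n\<close> has a single column, hence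
  \<open>V\<close>.\<close>

lemma peak_valley_pair_move:
  assumes p: "p \<le> Suc n" "h p = M" and ab: "matched a b" "h a \<noteq> M"
  shows "\<exists>m. applicable n m (walk_scheme n h) \<and> support m = edges_between (peak p) {a, b}"
proof -
  note d = matched_steps[OF ab(1)]
  have lt: "a < b" "b \<le> n"
    using ab by (auto simp: matched_def)
  consider (before_end) "p < a" "p = 0" | (before) q where "p < a" "p = Suc q"
    | (after_end) "Suc b < p" "p = Suc n" | (after) q where "Suc b < p" "p = Suc q" "q < n"
    using matched_peak_sides[OF ab(1) p(2) ab(2)] p(1)
    by (metis Suc_le_mono le_neq_implies_less not0_implies_Suc not_less_zero)
  then show ?thesis
  proof cases
    case before_end
    then show ?thesis
      using d lt peak_steps[OF p(2)]
      by (intro exI[of _ "Move_H 1 a b"]) (auto simp: edges_between_def peak_def)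
  next
    case before
    then show ?thesis
      using d lt peak_steps[OF p(2)]
      by (intro exI[of _ "Move_S p (Suc p) a b"]) (auto simp: edges_between_def peak_def)
  next
    case after_end
    then show ?thesis
      using d lt peak_steps(2)[OF p(2), of n]
      by (intro exI[of _ "Move_V (Suc a) (Suc b) n"]) (auto simp: edges_between_def peak_def)
  next
    case after
    then show ?thesis
      using d lt peak_steps[OF p(2)]
      by (intro exI[of _ "Move_S (Suc a) (Suc b) q p"]) (auto simp: edges_between_def peak_def)
  qed
qed

lemma peak_unmatched_move:
  assumes p: "p \<le> Suc n" "h p = M" and k: "k \<in> low" "\<And>l. \<not> matched k l" "\<And>l. \<not> matched l k"
  shows "\<exists>m. applicable n m (walk_scheme n h) \<and> support m = edges_between (peak p) {k}"
proof -
  have kn: "k \<le> n" "h k \<noteq> M" "h (Suc k) \<noteq> M"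
    using k(1) by (auto simp: low_def)
  have "p \<noteq> k" "p \<noteq> Suc k"
    using kn p by auto
  \<comment> \<open>Otherwise the visit to the maximum at \<open>p\<close> would force a partner: to
    the left of an up step after \<open>p\<close>, or to the right of a down step before
    \<open>p\<close>.\<close>
  have d: "if p < k then step h k = -1 else step h k = 1"
    using step_sign[OF kn(1)] exists_match_right[of k p] exists_match_left[of p k]
      k(2,3) p le_M[of k] le_M[of "Suc k"] kn \<open>p \<noteq> k\<close> by (auto split: if_splits)
  have sides: "p < k \<or> Suc k < p"
    using \<open>p \<noteq> k\<close> \<open>p \<noteq> Suc k\<close> by linarith
  consider (before_end) "p < k" "p = 0" | (before) q where "p < k" "p = Suc q"
    | (after_end) "Suc k < p" "p = Suc n" | (after) q where "Suc k < p" "p = Suc q" "q < n"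
    using sides p(1) by (cases p) (auto simp: le_less)
  then show ?thesis
  proof cases
    case before_end
    then show ?thesis
      using d kn peak_steps[OF p(2)]
      by (intro exI[of _ "Move_P 1 k"]) (auto simp: edges_between_def peak_def)
  next
    case before
    then show ?thesis
      using d kn peak_steps[OF p(2)]
      by (intro exI[of _ "Move_V p (Suc p) k"]) (auto simp: edges_between_def peak_def)
  next
    case after_end
    then show ?thesis
      using d kn peak_steps(2)[OF p(2), of n]
      by (intro exI[of _ "Move_P (Suc k) n"]) (auto simp: edges_between_def peak_def)
  next
    case after
    then show ?thesis
      using d kn peak_steps[OF p(2)]
      by (intro exI[of _ "Move_H (Suc k) q p"]) (auto simp: edges_between_def peak_def)
  qed
qed

text \<open>Both steps of the pair have an end at height \<open>h a\<close>, so one low step rules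
  out \<open>h a = M\<close>; then the whole stretch stays below \<open>M\<close>.\<close>

lemma matched_low:
  assumes "matched a b" "k = a \<or> k = b" "k \<in> low"
  shows "h a \<noteq> M" "{a, b} \<subseteq> low"
proof -
  show a: "h a \<noteq> M"
    using assms by (auto simp: low_def matched_def)
  then have "h a < M"
    using assms le_M[of a] by (auto simp: matched_def)
  then show "{a, b} \<subseteq> low"
    using assms(1) a by (force simp: low_def matched_def)
qed

lemma peak_valley_move:
  assumes "p \<le> Suc n" "h p = M" "k \<in> low"
  shows "\<exists>m. applicable n m (walk_scheme n h) \<and> support m = edges_between (peak p) (valley k)"
proof (cases k rule: valley_cases)
  case (pair a b)
  then show ?thesis
    using peak_valley_pair_move[OF assms(1,2) pair(1)] matched_low(1)[OF pair(1,3) assms(3)] by simp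
next
  case single
  then show ?thesis
    using peak_unmatched_move[OF assms single(2,3)] by simp
qed

section \<open>Tiling the sign changes of a fold by supports of moves\<close>

lemma valley_subset_low:
  assumes "k \<in> low"
  shows "valley k \<subseteq> low"
proof (cases k rule: valley_cases)
  case (pair a b)
  then show ?thesis
    using matched_low(2)[OF pair(1,3) assms] by simp
qed (use assms in simp)

lemma peak_subset_high: "h p = M \<Longrightarrow> peak p \<subseteq> high"
  by (auto simp: peak_def high_def)

lemma peak_disjoint:
  assumes "h p = M" "h q = M" "p \<noteq> q"
  shows "peak p \<inter> peak q = {}"
proof (rule ccontr)
  assume "peak p \<inter> peak q \<noteq> {}"
  then obtain k where k: "k \<le> n" "k = p \<or> Suc k = p" "k = q \<or> Suc k = q"
    by (auto simp: peak_def)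
  then have "h k = M" "h (Suc k) = M"
    using assms by auto
  with step_cases[OF k(1)] show False by simp
qed

lemma high_low_disjoint: "high \<inter> low = {}"
  by (auto simp: high_def low_def)

text \<open>Peaks partition \<open>high\<close> and valleys partition \<open>low\<close>, so the
  blocks formed by one of each tile the edges between the two sets.\<close>

lemma transforms_fold_blocks:
  "\<exists>ms. transforms n ms (walk_scheme n h) (flip (edges_between high low) (walk_scheme n h))"
proof -
  define B where "B = (\<lambda>(p, k). edges_between (peak p) (valley k)) ` ({p. p \<le> Suc n \<and> h p = M} \<times> low)"
  have "finite B"
    by (auto simp: B_def low_def)
  moreover have "pairwise disjnt B"
  proof (rule pairwiseI)
    fix E E' assume E: "E \<in> B" "E' \<in> B" "E \<noteq> E'"
    then obtain p k p' k' where pk: "E = edges_between (peak p) (valley k)" "h p = M" "k \<in> low"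
      "E' = edges_between (peak p') (valley k')" "h p' = M" "k' \<in> low"
      by (auto simp: B_def)
    then have "p \<noteq> p' \<or> valley k \<noteq> valley k'"
      using E(3) by auto
    then have "peak p \<inter> peak p' = {} \<or> valley k \<inter> valley k' = {}"
      using peak_disjoint[OF pk(2,5)] valley_eq by blast
    then show "disjnt E E'"
      unfolding pk(1,4)
      using pk peak_subset_high valley_subset_low high_low_disjoint
      by (intro disjnt_edges_between) blast+
  qed
  moreover have "\<exists>m. applicable n m (walk_scheme n h) \<and> support m = E" if "E \<in> B" for E
    using that peak_valley_move by (auto simp: B_def)
  moreover have "\<Union>B = edges_between high low"
  proof -
    have "k \<le> Suc n \<and> Suc k \<le> Suc n" if "k \<le> n" for k
      using that by simp
    then have "high = (\<Union>p \<in> {p. p \<le> Suc n \<and> h p = M}. peak p)"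
      unfolding high_def peak_def by blast
    moreover have "k \<in> valley k" for k
      by (simp add: valley_def)
    then have "low = (\<Union>k \<in> low. valley k)"
      using valley_subset_low by blast
    ultimately have "edges_between high low =
        edges_between (\<Union>p \<in> {p. p \<le> Suc n \<and> h p = M}. peak p) (\<Union>k \<in> low. valley k)"
      by simp
    also have "\<dots> = \<Union>B"
      by (fastforce simp: B_def edges_between_def)
    finally show ?thesis ..
  qed
  ultimately show ?thesis
    using transforms_disjoint_flips[of B n "walk_scheme n h"] by simp
qed

text \<open>A step between \<open>M - 1\<close> and \<open>M\<close> becomes one between
  \<open>M - 1\<close> and \<open>M - 2\<close>, which reverses its direction.\<close>

lemma step_fold_top:
  assumes "k \<le> n"
  shows "step (fold_top M h) k = (if k \<in> high then - step h k else step h k)"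
  using assms step_cases[OF assms] le_M[of k] le_M[of "Suc k"]
  by (auto simp: step_def fold_top_def high_def)

text \<open>A label is a product of two steps, so it changes sign exactly when one of them is high
  and the other low.\<close>

lemma walk_scheme_fold_top:
  "walk_scheme n (fold_top M h) = flip (edges_between high low) (walk_scheme n h)"
proof (rule ext, clarify)
  fix i j
  show "walk_scheme n (fold_top M h) (i, j) = flip (edges_between high low) (walk_scheme n h) (i, j)"
  proof (cases "(i, j) \<in> triangle n")
    case True
    then obtain a where a: "i = Suc a" "a < j" "j \<le> n"
      by (cases i) (auto simp: triangle_def)
    have "k \<in> low \<longleftrightarrow> k \<notin> high" if "k \<le> n" for k
      using that by (auto simp: low_def high_def)
    then show ?thesis
      using a by (auto simp: step_fold_top flip_def edges_between_def)
  next
    case False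
    then have "(i, j) \<notin> edges_between high low"
      by (auto simp: triangle_def edges_between_def high_def low_def)
    then show ?thesis
      using False by (simp add: walk_scheme_def flip_def)
  qed
qed

lemma transforms_fold_top:
  "\<exists>ms. transforms n ms (walk_scheme n h) (walk_scheme n (fold_top M h))"
  using transforms_fold_blocks by (simp add: walk_scheme_fold_top)

lemma walk_fold_top: "walk n (fold_top M h)"
proof
  show "step (fold_top M h) k = 1 \<or> step (fold_top M h) k = -1" if "k \<le> n" for k
    using step_fold_top[OF that] step_sign[OF that] by auto
qed

end

section \<open>Iterated folding down to two levels\<close>

lemma walk_transforms_minus:
  assumes "walk n h" "\<And>k. k \<le> Suc n \<Longrightarrow> m \<le> h k \<and> h k \<le> m + 1 + int r"
  shows "\<exists>ms. transforms n ms (walk_scheme n h) (minus_scheme n)"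
  using assms
proof (induction r arbitrary: h)
  case 0
  then have "transforms n [] (walk_scheme n h) (minus_scheme n)"
    using walk.walk_scheme_two_values[of n h m] by simp
  then show ?case by blast
next
  case (Suc r)
  \<comment> \<open>This is the assumed upper bound, attained or not. As
    \<open>M - 2 = m + int r\<close>, the fold respects the lower bound \<open>m\<close>.\<close>
  define M where "M = m + 2 + int r"
  interpret walk n h by fact
  interpret bounded_walk n h M
  proof
    show "h k \<le> M" if "k \<le> Suc n" for k
      using Suc.prems(2)[OF that] by (simp add: M_def)
  qed
  have "m \<le> fold_top M h k \<and> fold_top M h k \<le> m + 1 + int r" if "k \<le> Suc n" for k
    using Suc.prems(2)[OF that] by (auto simp: fold_top_def M_def)
  then obtain ms where "transforms n ms (walk_scheme n (fold_top M h)) (minus_scheme n)"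
    using Suc.IH[OF walk_fold_top] by blast
  then show ?case
    using transforms_fold_top transforms_append by blast
qed

lemma generated_scheme_eq_walk_scheme:
  assumes "\<forall>k \<in> {1..n}. \<epsilon> k \<in> signs"
  obtains h where "walk n h" "generated_scheme n \<epsilon> = walk_scheme n h"
proof
  \<comment> \<open>Partial sums of the partial products, so that consecutive steps multiply to
    \<open>\<epsilon> k\<close>. The empty product makes step 0 an up step.\<close>
  define h where "h = (\<lambda>k. \<Sum>j<k. \<Prod>l=1..j. \<epsilon> l)"
  have step: "step h k = (\<Prod>l=1..k. \<epsilon> l)" for k
    by (simp add: step_def h_def)
  have sign: "k \<le> n \<Longrightarrow> step h k = 1 \<or> step h k = -1" for k
    unfolding step
  proof (induction k)
    case (Suc k)
    then have "\<epsilon> (Suc k) = 1 \<or> \<epsilon> (Suc k) = -1"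
      using assms by (auto simp: signs_def)
    with Suc show ?case by auto
  qed simp
  then show "walk n h"
    by unfold_locales
  have "step h (k - 1) * step h k = \<epsilon> k" if k: "1 \<le> k" "k \<le> n" for k
  proof -
    obtain l where l: "k = Suc l"
      using k by (cases k) auto
    have "step h k = step h l * \<epsilon> k"
      by (simp add: l step)
    then show ?thesis
      using sign[of l] k l by auto
  qed
  then have "(\<Prod>k = i..j. step h (k - 1) * step h k) = prod \<epsilon> {i..j}" if "(i, j) \<in> triangle n" for i j
    using that by (intro prod.cong refl) (simp_all add: triangle_def)
  then show "generated_scheme n \<epsilon> = walk_scheme n h"
    unfolding walk.walk_scheme_eq_generated[OF \<open>walk n h\<close>] generated_scheme_def
    by (intro restrict_ext) (simp only: split_paired_all case_prod_conv)
qed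

theorem theorem2:
  fixes n :: nat and \<epsilon> :: "nat \<Rightarrow> int"
  assumes "n \<ge> 1"
    and "\<forall>k \<in> {1..n}. \<epsilon> k \<in> signs"
  shows "\<exists>ms :: move list. transforms n ms (generated_scheme n \<epsilon>) (minus_scheme n)"
proof -
  obtain h where h: "walk n h" "generated_scheme n \<epsilon> = walk_scheme n h"
    using generated_scheme_eq_walk_scheme[OF assms(2)] .
  define m where "m = Min (h ` {..Suc n})"
  define M where "M = Max (h ` {..Suc n})"
  \<comment> \<open>The bound lies one level above the true maximum, so a first fold there changes
    no value in the range of the walk.\<close>
  have "m \<le> h k \<and> h k \<le> m + 1 + int (nat (M - m))" if "k \<le> Suc n" for k
  proof -
    have "m \<le> h k" "h k \<le> M"
      using that by (simp_all add: m_def M_def)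
    then show ?thesis by simp
  qed
  then show ?thesis
    using walk_transforms_minus[OF h(1)] h(2) by metis
qed

end
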